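(* Let $A(x),B(x)$, the saturation function $\mathrm{sat}$ with levels $\bar u_1,\dots,\bar u_m>0$, be as in the context, let $r>0$ be such that $\mathcal{B}_r\subseteq\mathbb{X}$, and let $\bar{\mathcal{G}}$ be the finite vertex set defined in the context. Suppose there exist a symmetric matrix $\Gamma\in\mathbb{R}^{n\times n}$ with $\Gamma\succ0$, a real number $\epsilon_\Gamma>0$, matrices $Y,W\in\mathbb{R}^{m\times n}$ and a diagonal positive definite matrix $S\in\mathbb{R}^{m\times m}$ such that $$\begin{bmatrix}\Gamma & W_{(i)}^\top \\ W_{(i)} & \bar u_i^2\end{bmatrix}\succeq0,\qquad i=1,\dots,m,$$ $$\begin{bmatrix}-\Gamma+\epsilon_\Gamma I_n & -Y^\top-W^\top & \begin{bmatrix}\Gamma \\ Y\end{bmatrix}^\top G^\top \\ -Y-W & -2S & \begin{bmatrix}0 \\ S\end{bmatrix}^\top G^\top \\ G\begin{bmatrix}\Gamma \\ Y\end{bmatrix} & G\begin{bmatrix}0 \\ S\end{bmatrix} & -\Gamma\end{bmatrix}\preceq0\qquad\text{for all }G\in\bar{\mathcal{G}} .$$ Let $u=Kx$ with $K=Y\Gamma^{-1}$, and let $P=\Gamma^{-1}$. Then $\mathcal{B}_{r_0}\cap\mathcal{E}_{P,1}$, with $$r_0=\min\left\{r,\ \sqrt{\frac{\lambda_{\max}(\Gamma)\lambda_{\min}(\Gamma)}{\lambda_{\max}^2(\Gamma)-\epsilon_\Gamma\lambda_{\min}(\Gamma)}}\cdot r\right\}$$ (the quotient being read as $+\infty$ if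 its denominator is $0$), is a region of attraction of the closed-loop system $x^{+}=A(x)x+B(x)\,\mathrm{sat}(Kx)$ relative to the equilibrium $0$, and this closed-loop system starting from any $x(0)\in\mathcal{B}_{r_0}\cap\mathcal{E}_{P,1}$ exponentially converges to the origin.
   Context: Setting: $n,m\ge1$; $\mathbb{X}\subseteq\mathbb{R}^n$ contains the origin; $A(x)=[a_{ij}(x)]_{n\times n}$ and $B(x)=[b_{ij}(x)]_{n\times m}$ with entries $a_{ij},b_{ij}:\mathbb{X}\to\mathbb{R}$ continuous. The system is the discrete-time system $x^{+}=A(x)x+B(x)\,\mathrm{sat}(u)$, $x^{+}(k)=x(k+1)$, $k\in\mathbb{N}=\{0,1,2,\dots\}$, where $\mathrm{sat}:\mathbb{R}^m\to\mathbb{R}^m$ acts componentwise by $\mathrm{sat}(u_i)=\mathrm{sign}(u_i)\min(|u_i|,\bar u_i)$, with given $\bar u_i>0$. Notation: $|\cdot|$ is the Euclidean norm; $\mathcal{B}_r=\{x\in\mathbb{R}^n:|x|\le r\}$; $\mathcal{E}_{M,\tau}=\{x\in\mathbb{R}^n:x^\top Mx\le\tau\}$; $M_{(i)}$ is the $i$-th row of $M$; $\lambda_{\max},\lambda_{\min}$ are the largest and smallest eigenvalues of a symmetric matrix; $\succ,\succeq,\preceq$ denote the Loewner order. In $\begin{bmatrix}0 \\ S\end{bmatrix}$ the zero block is $n\times m$. Vertex set: with $\bar a_{ij}=\max_{x\in\mathcal{B}_r}a_{ij}(x)$, $\underline a_{ij}=\min_{x\in\mathcal{B}_r}a_{ij}(x)$,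 $\bar b_{ij}=\max_{x\in\mathcal{B}_r}b_{ij}(x)$, $\underline b_{ij}=\min_{x\in\mathcal{B}_r}b_{ij}(x)$, $$\bar{\mathcal{G}}=\Big\{\big[[\alpha_{ij}]_{n\times n}\ \ [\beta_{ij}]_{n\times m}\big]\in\mathbb{R}^{n\times(n+m)}:\alpha_{ij}\in\{\bar a_{ij},\underline a_{ij}\},\ \beta_{ij}\in\{\bar b_{ij},\underline b_{ij}\}\Big\}.$$ A set $\mathcal{R}\subset\mathbb{R}^n$ is a region of attraction of $x^{+}=f(x)$ relative to the equilibrium $0$ if for every $x(0)\in\mathcal{R}$ the solution satisfies $\lim_{k\to\infty}x(k)=0$. Exponential convergence to the origin from a set $\mathcal{R}$ means there are constants $c>0$, $\rho\in(0,1)$ such that $|x(k)|\le c\rho^k|x(0)|$ for all $k\in\mathbb{N}$ and all $x(0)\in\mathcal{R}$. These claims include that the solution remains in $\mathbb{X}$, so that it is defined for all $k$. *)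

theory Defs
  imports "HOL-Analysis.Analysis"
begin

definition hcat :: "real^'a^'n \<Rightarrow> real^'b^'n \<Rightarrow> real^('a + 'b)^'n" where
  "hcat M N = (\<chi> i j. case j of Inl k \<Rightarrow> M $ i $ k | Inr k \<Rightarrow> N $ i $ k)"

definition vcat :: "real^'n^'a \<Rightarrow> real^'n^'b \<Rightarrow> real^'n^('a + 'b)" where
  "vcat M N = (\<chi> i. case i of Inl k \<Rightarrow> M $ k | Inr k \<Rightarrow> N $ k)"

definition pos_semidef :: "real^'n^'n \<Rightarrow> bool" where
  "pos_semidef M \<longleftrightarrow> transpose M = M \<and> (\<forall>x. 0 \<le> x \<bullet> (M *v x))"

definition pos_def :: "real^'n^'n \<Rightarrow> bool" where
  "pos_def M \<longleftrightarrow> transpose M = M \<and> (\<forall>x. x \<noteq> 0 \<longrightarrow> 0 < x \<bullet> (M *v x))"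

definition loewner_le :: "real^'n^'n \<Rightarrow> real^'n^'n \<Rightarrow> bool" where
  "loewner_le M N \<longleftrightarrow> pos_semidef (N - M)"

definition loewner_less :: "real^'n^'n \<Rightarrow> real^'n^'n \<Rightarrow> bool" where
  "loewner_less M N \<longleftrightarrow> pos_def (N - M)"

definition diagonal_mat :: "real^'n^'n \<Rightarrow> bool" where
  "diagonal_mat M \<longleftrightarrow> (\<forall>i j. i \<noteq> j \<longrightarrow> M $ i $ j = 0)"

(* Real eigenvalues only; below these are used for symmetric matrices, where
   the set is finite and nonempty, so that Max and Min are meaningful. *)
definition eigenvalues :: "real^'n^'n \<Rightarrow> real set" where
  "eigenvalues M = {c. \<exists>v. v \<noteq> 0 \<and> M *v v = c *\<^sub>R v}"

definition lambda_max :: "real^'n^'n \<Rightarrow> real" where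
  "lambda_max M = Max (eigenvalues M)"

definition lambda_min :: "real^'n^'n \<Rightarrow> real" where
  "lambda_min M = Min (eigenvalues M)"

definition ellipsoid :: "real^'n^'n \<Rightarrow> real \<Rightarrow> (real^'n) set" where
  "ellipsoid M \<tau> = {x. x \<bullet> (M *v x) \<le> \<tau>}"

definition sat :: "real^'m \<Rightarrow> real^'m \<Rightarrow> real^'m" where
  "sat ubar u = (\<chi> i. sgn (u $ i) * min \<bar>u $ i\<bar> (ubar $ i))"

(* The right-hand side of the system under the feedback u = K x. *)
definition closed_loop ::
  "(real^'n \<Rightarrow> real^'n^'n) \<Rightarrow> (real^'n \<Rightarrow> real^'m^'n) \<Rightarrow> real^'m \<Rightarrow> real^'n^'m
    \<Rightarrow> real^'n \<Rightarrow> real^'n" where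
  "closed_loop A B ubar K x = A x *v x + B x *v sat ubar (K *v x)"

(* SUP and INF are the maximum and minimum over the compact ball when the
   entries are continuous there. *)
definition entry_max :: "(real^'n \<Rightarrow> real^'p^'q) \<Rightarrow> real \<Rightarrow> 'q \<Rightarrow> 'p \<Rightarrow> real" where
  "entry_max M r i j = (SUP x\<in>cball 0 r. M x $ i $ j)"

definition entry_min :: "(real^'n \<Rightarrow> real^'p^'q) \<Rightarrow> real \<Rightarrow> 'q \<Rightarrow> 'p \<Rightarrow> real" where
  "entry_min M r i j = (INF x\<in>cball 0 r. M x $ i $ j)"

definition vertex_set ::
  "(real^'n \<Rightarrow> real^'n^'n) \<Rightarrow> (real^'n \<Rightarrow> real^'m^'n) \<Rightarrow> real
    \<Rightarrow> (real^('n + 'm)^'n) set" where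
  "vertex_set A B r =
    {hcat \<alpha> \<beta> | \<alpha> \<beta>.
      (\<forall>i j. \<alpha> $ i $ j \<in> {entry_max A r i j, entry_min A r i j}) \<and>
      (\<forall>i j. \<beta> $ i $ j \<in> {entry_max B r i j, entry_min B r i j})}"

(* The map f is meaningful only on X, hence the requirement that the iterates
   (the solution from x0) stay in X. *)
definition region_of_attraction ::
  "(real^'n) set \<Rightarrow> (real^'n \<Rightarrow> real^'n) \<Rightarrow> (real^'n) set \<Rightarrow> bool" where
  "region_of_attraction X f R \<longleftrightarrow>
    (\<forall>x0\<in>R. (\<forall>k. (f ^^ k) x0 \<in> X) \<and> (\<lambda>k. (f ^^ k) x0) \<longlonglongrightarrow> 0)"

definition exponentially_convergent ::
  "(real^'n) set \<Rightarrow> (real^'n \<Rightarrow> real^'n) \<Rightarrow> (real^'n) set \<Rightarrow> bool" where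
  "exponentially_convergent X f R \<longleftrightarrow>
    (\<forall>x0\<in>R. \<forall>k. (f ^^ k) x0 \<in> X) \<and>
    (\<exists>c \<rho>. 0 < c \<and> 0 < \<rho> \<and> \<rho> < 1 \<and>
      (\<forall>x0\<in>R. \<forall>k. norm ((f ^^ k) x0) \<le> c * \<rho> ^ k * norm x0))"

(* The quotient under the root is read as infinity when its denominator is 0;
   the minimum is then r. *)
definition attraction_radius :: "real^'n^'n \<Rightarrow> real \<Rightarrow> real \<Rightarrow> real" where
  "attraction_radius \<Gamma> \<epsilon> r =
    (let d = (lambda_max \<Gamma>)\<^sup>2 - \<epsilon> * lambda_min \<Gamma> in
     if d = 0 then r
     else min r (sqrt (lambda_max \<Gamma> * lambda_min \<Gamma> / d) * r))"

end

theory Submission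
  imports Defs
begin

text \<open>
  Write \<open>V x = x \<bullet> P x\<close>. The block matrix inequality is tested on the vector
  \<open>(P x, S\<inverse> (sat (K x) - K x), P x\<^sup>+)\<close>. For such a fixed vector the form is affine in the
  entries of \<open>G\<close>, so its value at \<open>[A(x) B(x)]\<close> is at most its value at a suitable vertex.
  Together with the sector condition for the saturation, which holds on the ellipsoid by the
  row inequalities, this gives \<open>V x\<^sup>+ \<le> V x - \<epsilon> |P x|\<^sup>2\<close> as long as \<open>|x| \<le> r\<close> and \<open>V x \<le> 1\<close>.
  The radius of the initial ball is chosen so that \<open>\<lambda>\<^sub>m\<^sub>a\<^sub>x(\<Gamma>) V (x(1)) \<le> r\<^sup>2\<close>; since \<open>V\<close> decreases and
  \<open>|x|\<^sup>2 \<le> \<lambda>\<^sub>m\<^sub>a\<^sub>x(\<Gamma>) V x\<close>, the trajectory never leaves the ball of radius \<open>r\<close>.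
\<close>

section \<open>Positive semidefinite matrices and extreme eigenvalues\<close>

lemma matrix_neg_mult: "(- M) *v x = - (M *v x)" for M :: "real^'a^'b"
  by (simp add: vec_eq_iff matrix_vector_mult_def sum_negf)

text \<open>The form at \<open>b + t *\<^sub>R a\<close> is a nonnegative quadratic in
  \<open>t\<close>. As \<open>M\<close> is only semidefinite, its leading coefficient may vanish,
  and the linear case is treated apart.\<close>

lemma pos_semidef_cauchy_schwarz:
  fixes M :: "real^'n^'n"
  assumes "pos_semidef M"
  shows "(a \<bullet> (M *v b))\<^sup>2 \<le> (a \<bullet> (M *v a)) * (b \<bullet> (M *v b))"
proof -
  define p q s where "p = a \<bullet> (M *v a)" and "q = a \<bullet> (M *v b)" and "s = b \<bullet> (M *v b)"
  have psd: "0 \<le> x \<bullet> (M *v x)" for x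
    using assms by (simp add: pos_semidef_def)
  have sym: "b \<bullet> (M *v a) = q"
    using assms by (metis dot_lmul_matrix inner_commute pos_semidef_def q_def vector_transpose_matrix)
  have quad: "0 \<le> s + 2 * t * q + t\<^sup>2 * p" for t
  proof -
    have "(b + t *\<^sub>R a) \<bullet> (M *v (b + t *\<^sub>R a)) = s + 2 * t * q + t\<^sup>2 * p"
      using sym
      by (simp add: p_def q_def s_def matrix_vector_right_distrib matrix_vector_mult_scaleR
          inner_add_left inner_add_right algebra_simps power2_eq_square)
    then show ?thesis
      using psd by metis
  qed
  have "q\<^sup>2 \<le> p * s"
  proof (cases "p = 0")
    case True
    have "q = 0"
    proof (rule ccontr)
      assume "q \<noteq> 0"
      \<comment> \<open>At this \<open>t\<close> the linear function \<open>s + 2 * t * q\<close>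
        takes the value -1.\<close>
      then show False
        using quad[of "- (s + 1) / (2 * q)"] True by (simp add: field_simps)
    qed
    then show ?thesis
      using True by simp
  next
    case False
    then have "p > 0"
      using psd[of a] by (simp add: p_def)
    \<comment> \<open>\<open>- q / p\<close> minimises the quadratic.\<close>
    then show ?thesis
      using quad[of "- q / p"] by (simp add: field_simps power2_eq_square)
  qed
  then show ?thesis
    by (simp add: p_def q_def s_def)
qed

text \<open>Cauchy-Schwarz with first argument \<open>M *v v\<close> bounds the fourth power of the
  norm of \<open>M *v v\<close> by a product with the factor
  \<open>v \<bullet> (M *v v)\<close>.\<close>

lemma pos_semidef_kernel:
  assumes "pos_semidef M" and "v \<bullet> (M *v v) = 0"
  shows "M *v v = 0"
  using pos_semidef_cauchy_schwarz[OF assms(1), of v "M *v v"]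
    pos_semidef_cauchy_schwarz[OF assms(1), of "M *v v" v] assms(2) by simp

text \<open>Eigenvectors for distinct eigenvalues are orthogonal, so one eigenvector per eigenvalue
  gives an independent set. Finiteness makes \<open>Max\<close> and \<open>Min\<close> in
  \<open>lambda_max\<close> and \<open>lambda_min\<close> meaningful.\<close>

lemma finite_eigenvalues_symmetric:
  fixes M :: "real^'n^'n"
  assumes "transpose M = M"
  shows "finite (eigenvalues M)"
proof -
  have "\<forall>c\<in>eigenvalues M. \<exists>v. v \<noteq> 0 \<and> M *v v = c *\<^sub>R v"
    by (simp add: eigenvalues_def)
  from bchoice[OF this] obtain f where "\<forall>c\<in>eigenvalues M. f c \<noteq> 0 \<and> M *v f c = c *\<^sub>R f c" ..
  then have f: "f c \<noteq> 0" "M *v f c = c *\<^sub>R f c" if "c \<in> eigenvalues M" for c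
    using that by blast+
  have orth: "orthogonal (f c) (f d)"
    if "c \<in> eigenvalues M" "d \<in> eigenvalues M" "c \<noteq> d" for c d
  proof -
    have "f c \<bullet> (M *v f d) = (M *v f c) \<bullet> f d"
      using assms by (metis dot_lmul_matrix vector_transpose_matrix)
    then have "(d - c) * (f c \<bullet> f d) = 0"
      using that f by (simp add: algebra_simps)
    then show ?thesis
      using that by (simp add: orthogonal_def)
  qed
  have inj: "inj_on f (eigenvalues M)"
    by (metis inj_onI orth f(1) orthogonal_self)
  have "pairwise orthogonal (f ` eigenvalues M)"
    using orth by (auto simp: pairwise_def)
  then have "independent (f ` eigenvalues M)"
    using f(1) by (intro pairwise_orthogonal_independent) auto
  then have "finite (f ` eigenvalues M)"
    by (rule independent_imp_finite)
  then show ?thesis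
    using inj finite_imageD by blast
qed

text \<open>Let \<open>c\<close> be the maximum of the form on the unit sphere. Then
  \<open>c *\<^sub>R mat 1 - M\<close> is semidefinite and its form vanishes at a maximiser, which
  therefore lies in the kernel and is an eigenvector. This also shows that eigenvalues
  exist.\<close>

lemma rayleigh_max_eigenvalue:
  fixes M :: "real^'n^'n"
  assumes "transpose M = M"
  obtains c where "c \<in> eigenvalues M" and "\<And>x. x \<bullet> (M *v x) \<le> c * (norm x)\<^sup>2"
proof -
  have "continuous_on (sphere 0 1) (\<lambda>x::real^'n. x \<bullet> (M *v x))"
    by (intro continuous_intros matrix_vector_mult_linear_continuous_on)
  moreover have "sphere (0::real^'n) 1 \<noteq> {}"
    by simp
  ultimately obtain v where v: "v \<in> sphere 0 1"
      and max: "\<And>y. y \<in> sphere 0 1 \<Longrightarrow> y \<bullet> (M *v y) \<le> v \<bullet> (M *v v)"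
    using continuous_attains_sup[of "sphere 0 1" "\<lambda>x::real^'n. x \<bullet> (M *v x)"] compact_sphere
    by blast
  define c where "c = v \<bullet> (M *v v)"
  have bound: "x \<bullet> (M *v x) \<le> c * (norm x)\<^sup>2" for x
  proof (cases "x = 0")
    case False
    then have "(x /\<^sub>R norm x) \<bullet> (M *v (x /\<^sub>R norm x)) \<le> c"
      unfolding c_def by (intro max) simp
    then show ?thesis
      using False by (simp add: matrix_vector_mult_scaleR field_simps power2_eq_square)
  qed simp
  have eq: "(c *\<^sub>R mat 1 - M) *v x = c *\<^sub>R x - M *v x" for x
    by (simp add: matrix_vector_mult_diff_rdistrib scaleR_matrix_vector_assoc[symmetric])
  have "transpose (c *\<^sub>R mat 1 - M) = c *\<^sub>R mat 1 - M"
    using assms by (simp add: vec_eq_iff transpose_def mat_def)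
  then have "pos_semidef (c *\<^sub>R mat 1 - M)"
    unfolding pos_semidef_def eq
    using bound by (simp add: inner_diff_right power2_norm_eq_inner)
  moreover have "v \<bullet> ((c *\<^sub>R mat 1 - M) *v v) = 0"
    using v unfolding eq by (simp add: inner_diff_right c_def flip: power2_norm_eq_inner)
  ultimately have "M *v v = c *\<^sub>R v"
    using pos_semidef_kernel eq by (metis eq_iff_diff_eq_0)
  then have "c \<in> eigenvalues M"
    using v by (auto simp: eigenvalues_def intro!: exI[of _ v])
  then show ?thesis
    using bound that by blast
qed

lemma eigenvalues_uminus: "eigenvalues (- M) = uminus ` eigenvalues M"
proof -
  have "(- M) *v v = c *\<^sub>R v \<longleftrightarrow> M *v v = (- c) *\<^sub>R v" for c v
    unfolding matrix_neg_mult by (metis add.inverse_inverse scaleR_minus_left)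
  then have "c \<in> eigenvalues (- M) \<longleftrightarrow> - c \<in> eigenvalues M" for c
    unfolding eigenvalues_def by simp
  then have "eigenvalues (- M) = {c. - c \<in> eigenvalues M}"
    by blast
  also have "\<dots> = uminus ` eigenvalues M"
    by force
  finally show ?thesis .
qed

lemma lambda_max_bound:
  assumes "transpose M = M"
  shows "x \<bullet> (M *v x) \<le> lambda_max M * (norm x)\<^sup>2"
proof -
  obtain c where c: "c \<in> eigenvalues M" "x \<bullet> (M *v x) \<le> c * (norm x)\<^sup>2"
    using rayleigh_max_eigenvalue[OF assms] by metis
  then have "c \<le> lambda_max M"
    unfolding lambda_max_def by (intro Max_ge finite_eigenvalues_symmetric assms)
  then have "c * (norm x)\<^sup>2 \<le> lambda_max M * (norm x)\<^sup>2"
    by (rule mult_right_mono) simp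
  with c(2) show ?thesis
    by (rule order_trans)
qed

lemma lambda_min_eigenvalue:
  assumes "transpose M = M"
  shows "lambda_min M \<in> eigenvalues M"
proof -
  have "eigenvalues M \<noteq> {}"
    using rayleigh_max_eigenvalue[OF assms] by (metis empty_iff)
  then show ?thesis
    unfolding lambda_min_def by (intro Min_in finite_eigenvalues_symmetric assms)
qed

text \<open>This is the Rayleigh bound for \<open>- M\<close>, whose eigenvalues are the negatives
  of those of \<open>M\<close>.\<close>

lemma lambda_min_bound:
  assumes "transpose M = M"
  shows "lambda_min M * (norm x)\<^sup>2 \<le> x \<bullet> (M *v x)"
proof -
  have "transpose (- M) = - M"
    using assms by (simp add: vec_eq_iff transpose_def)
  then obtain c where c: "c \<in> eigenvalues (- M)" "x \<bullet> ((- M) *v x) \<le> c * (norm x)\<^sup>2"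
    using rayleigh_max_eigenvalue by metis
  then have "- c \<in> eigenvalues M"
    by (auto simp: eigenvalues_uminus)
  then have "lambda_min M \<le> - c"
    unfolding lambda_min_def by (intro Min_le finite_eigenvalues_symmetric assms)
  then have "lambda_min M * (norm x)\<^sup>2 \<le> - c * (norm x)\<^sup>2"
    by (rule mult_right_mono) simp
  moreover have "x \<bullet> ((- M) *v x) = - (x \<bullet> (M *v x))"
    by (simp add: matrix_neg_mult)
  ultimately show ?thesis
    using c(2) by simp
qed

section \<open>Quadratic forms of block matrices\<close>

definition vec_join :: "real^'a \<Rightarrow> real^'b \<Rightarrow> real^('a + 'b)" where
  "vec_join x y = (\<chi> i. case i of Inl k \<Rightarrow> x $ k | Inr k \<Rightarrow> y $ k)"

lemma sum_UNIV_Plus: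
  fixes f :: "'a::finite + 'b::finite \<Rightarrow> 'c::comm_monoid_add"
  shows "sum f UNIV = (\<Sum>i\<in>UNIV. f (Inl i)) + (\<Sum>i\<in>UNIV. f (Inr i))"
  by (subst UNIV_Plus_UNIV[symmetric], subst sum.Plus) simp_all

lemma inner_vec_join: "vec_join x y \<bullet> vec_join x' y' = x \<bullet> x' + y \<bullet> y'"
  by (simp add: inner_vec_def vec_join_def sum_UNIV_Plus)

lemma hcat_mult_vec_join: "hcat M N *v vec_join x y = M *v x + N *v y"
  by (simp add: vec_eq_iff matrix_vector_mult_def hcat_def vec_join_def sum_UNIV_Plus)

lemma vcat_mult: "vcat M N *v x = vec_join (M *v x) (N *v x)"
  by (simp add: vec_eq_iff matrix_vector_mult_def vcat_def vec_join_def split: sum.split)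

lemma inner_vector_matrix_mult: "x \<bullet> (y v* M) = y \<bullet> (M *v x)"
  for M :: "real^'a^'b"
  by (metis dot_lmul_matrix inner_commute)

text \<open>Cauchy-Schwarz for the block matrix between (0, 1) and (\<xi>, 0): the mixed term is
  \<open>w \<bullet> \<xi>\<close>, the two diagonal terms are \<open>u\<^sup>2\<close> and the form
  of \<Gamma> at \<xi>. No Schur complement is formed.\<close>

lemma ellipsoid_row_bound:
  fixes \<Gamma> :: "real^'n^'n" and w :: "real^'n"
  assumes "loewner_le 0
      (vcat (hcat \<Gamma> (transpose (rowvector w :: real^'n^1)))
            (hcat (rowvector w) (mat (u\<^sup>2))))"
    and "\<xi> \<bullet> (\<Gamma> *v \<xi>) \<le> 1"
  shows "(w \<bullet> \<xi>)\<^sup>2 \<le> u\<^sup>2"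
proof -
  define M where "M = vcat (hcat \<Gamma> (transpose (rowvector w :: real^'n^1)))
            (hcat (rowvector w) (mat (u\<^sup>2)))"
  have "pos_semidef M"
    using assms(1) by (simp add: loewner_le_def M_def)
  have row: "1 \<bullet> ((rowvector w :: real^'n^1) *v x) = w \<bullet> x" for x
    by (simp add: inner_vec_def matrix_vector_mult_def rowvector_def)
  have mat1: "1 \<bullet> ((mat c :: real^1^1) *v 1) = c" for c
    by (simp add: inner_vec_def matrix_vector_mult_def mat_def)
  from pos_semidef_cauchy_schwarz[OF \<open>pos_semidef M\<close>, of "vec_join 0 1" "vec_join \<xi> 0"]
  have "(w \<bullet> \<xi>)\<^sup>2 \<le> u\<^sup>2 * (\<xi> \<bullet> (\<Gamma> *v \<xi>))"
    by (simp add: M_def vcat_mult hcat_mult_vec_join inner_vec_join row mat1)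
  also have "\<dots> \<le> u\<^sup>2"
    using assms(2) by (simp add: mult_left_le)
  finally show ?thesis .
qed

lemma loewner_le_zero_quadratic: "loewner_le M 0 \<Longrightarrow> x \<bullet> (M *v x) \<le> 0"
  by (simp add: loewner_le_def pos_semidef_def matrix_neg_mult)

text \<open>The block form is evaluated at (\<xi>, v, w). Each pair of transposed off-diagonal
  blocks contributes one doubled cross term, and the vertex enters only through the terms that
  contain \<open>w\<close>.\<close>

lemma lmi_quadratic_form:
  fixes \<Gamma> :: "real^'n^'n" and Y W :: "real^'n^'m" and S :: "real^'m^'m"
    and \<alpha> :: "real^'n^'n" and \<beta> :: "real^'m^'n"
  assumes "loewner_le
          (vcat (hcat (- \<Gamma> + \<epsilon> *\<^sub>R mat 1)
                      (hcat (- transpose Y - transpose W)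
                            (transpose (vcat \<Gamma> Y) ** transpose (hcat \<alpha> \<beta>))))
          (vcat (hcat (- Y - W)
                      (hcat (- (2 *\<^sub>R S))
                            (transpose (vcat 0 S) ** transpose (hcat \<alpha> \<beta>))))
                (hcat (hcat \<alpha> \<beta> ** vcat \<Gamma> Y)
                      (hcat (hcat \<alpha> \<beta> ** vcat 0 S)
                            (- \<Gamma>)))))
          0"
  shows "2 * (w \<bullet> (\<alpha> *v (\<Gamma> *v \<xi>)) + w \<bullet> (\<beta> *v (Y *v \<xi> + S *v v))) - w \<bullet> (\<Gamma> *v w)
    \<le> \<xi> \<bullet> (\<Gamma> *v \<xi>) - \<epsilon> * (norm \<xi>)\<^sup>2 + 2 * (v \<bullet> (Y *v \<xi> + W *v \<xi> + S *v v))"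
    (is "?L \<le> ?R")
proof -
  let ?z = "vec_join \<xi> (vec_join v w)"
  have "?z \<bullet> (vcat (hcat (- \<Gamma> + \<epsilon> *\<^sub>R mat 1)
                      (hcat (- transpose Y - transpose W)
                            (transpose (vcat \<Gamma> Y) ** transpose (hcat \<alpha> \<beta>))))
          (vcat (hcat (- Y - W)
                      (hcat (- (2 *\<^sub>R S))
                            (transpose (vcat 0 S) ** transpose (hcat \<alpha> \<beta>))))
                (hcat (hcat \<alpha> \<beta> ** vcat \<Gamma> Y)
                      (hcat (hcat \<alpha> \<beta> ** vcat 0 S)
                            (- \<Gamma>)))) *v ?z) = ?L - ?R"
    by (simp add: vcat_mult hcat_mult_vec_join inner_vec_join matrix_neg_mult
        matrix_vector_mult_add_rdistrib matrix_vector_mult_diff_rdistrib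
        matrix_vector_right_distrib scaleR_matrix_vector_assoc[symmetric]
        inner_add_right inner_diff_right inner_vector_matrix_mult
        matrix_transpose_mul[symmetric] matrix_vector_mul_assoc[symmetric]
        power2_norm_eq_inner algebra_simps)
  then show ?thesis
    using loewner_le_zero_quadratic[OF assms, of ?z] by linarith
qed

section \<open>Vertices and the sector condition\<close>

text \<open>With \<open>w\<close> and \<open>q\<close> fixed, the form is a sum over the entries of
  \<open>M\<close> with coefficients \<open>w $ i * q $ j\<close>. Each entry can be moved
  separately to the end of its interval selected by the sign of its coefficient.\<close>

lemma bilinear_le_vertex:
  fixes M :: "real^'p^'q"
  assumes "\<And>i j. lo i j \<le> M $ i $ j" and "\<And>i j. M $ i $ j \<le> hi i j"
  obtains N where "\<And>i j. N $ i $ j \<in> {hi i j, lo i j}" and "w \<bullet> (M *v q) \<le> w \<bullet> (N *v q)"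
proof
  let ?N = "\<chi> i j. if 0 \<le> w $ i * q $ j then hi i j else lo i j"
  show "?N $ i $ j \<in> {hi i j, lo i j}" for i j
    by simp
  have bilinear: "w \<bullet> (L *v q) = (\<Sum>i\<in>UNIV. \<Sum>j\<in>UNIV. L $ i $ j * (w $ i * q $ j))"
    for L :: "real^'p^'q"
    by (simp add: inner_vec_def matrix_vector_mult_def sum_distrib_left mult_ac)
  have "M $ i $ j * (w $ i * q $ j) \<le> ?N $ i $ j * (w $ i * q $ j)" for i j
    using assms by (simp add: mult_right_mono mult_right_mono_neg)
  then show "w \<bullet> (M *v q) \<le> w \<bullet> (?N *v q)"
    unfolding bilinear by (intro sum_mono)
qed

text \<open>Real \<open>SUP\<close> and \<open>INF\<close> bound the values only when the image is
  bounded, which compactness of the ball provides.\<close>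

lemma entry_bounds:
  assumes "continuous_on (cball 0 r) (\<lambda>x. M x $ i $ j)" and "x \<in> cball 0 r"
  shows "entry_min M r i j \<le> M x $ i $ j" and "M x $ i $ j \<le> entry_max M r i j"
proof -
  have "bounded ((\<lambda>x. M x $ i $ j) ` cball 0 r)"
    using assms(1) by (intro compact_imp_bounded compact_continuous_image) auto
  then show "entry_min M r i j \<le> M x $ i $ j" "M x $ i $ j \<le> entry_max M r i j"
    unfolding entry_min_def entry_max_def using assms(2)
    by (auto intro!: cINF_lower cSUP_upper bounded_imp_bdd_below bounded_imp_bdd_above)
qed

text \<open>Without saturation the first factor is zero. With saturation it has the sign opposite to
  the active limit, while the second factor cannot have the sign opposite to that limit, because
  \<open>h\<close> stays within the limits.\<close>

lemma sat_sector:
  assumes "0 < ubar $ i" and "h\<^sup>2 \<le> (ubar $ i)\<^sup>2"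
  shows "(sat ubar u $ i - u $ i) * (sat ubar u $ i + h) \<le> 0"
proof -
  have "\<bar>h\<bar> \<le> ubar $ i"
    using assms abs_le_square_iff[of h "ubar $ i"] by simp
  then consider "\<bar>u $ i\<bar> \<le> ubar $ i" | "u $ i > ubar $ i" | "u $ i < - ubar $ i"
    by linarith
  then show ?thesis
  proof cases
    case 1
    then show ?thesis
      by (simp add: sat_def sgn_mult_abs)
  next
    case 2
    then have "sat ubar u $ i = ubar $ i"
      using assms(1) by (simp add: sat_def)
    then show ?thesis
      using 2 \<open>\<bar>h\<bar> \<le> ubar $ i\<close> by (simp add: mult_nonpos_nonneg)
  next
    case 3
    then have "sat ubar u $ i = - ubar $ i"
      using assms(1) by (simp add: sat_def)
    then show ?thesis
      using 3 \<open>\<bar>h\<bar> \<le> ubar $ i\<close> by (simp add: mult_nonneg_nonpos)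
  qed
qed

lemma diagonal_mat_mult: "diagonal_mat S \<Longrightarrow> (S *v v) $ i = S $ i $ i * v $ i"
  unfolding matrix_vector_mult_def diagonal_mat_def vec_lambda_beta
  by (subst sum.remove[of _ i]) (auto intro: sum.neutral)

lemma pos_def_diag_entry:
  fixes S :: "real^'m^'m"
  assumes "pos_def S"
  shows "0 < S $ i $ i"
proof -
  have "0 < axis i 1 \<bullet> (S *v axis i 1)"
    using assms by (simp add: pos_def_def)
  then show ?thesis
    by (simp add: inner_axis' matrix_vector_mul_component inner_axis)
qed

lemma pos_def_matrix_inv:
  fixes M :: "real^'n^'n"
  assumes "pos_def M"
  shows "M *v (matrix_inv M *v x) = x"
proof -
  have "x = 0" if "M *v x = 0" for x
    using assms that by (metis inner_zero_right less_irrefl pos_def_def)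
  then have "invertible M"
    by (metis invertible_left_inverse matrix_left_invertible_ker)
  then have "M ** matrix_inv M = mat 1"
    unfolding invertible_def matrix_inv_def by (rule someI2_ex) simp
  then show ?thesis
    by (simp add: matrix_vector_mul_assoc)
qed

section \<open>Trajectories\<close>

text \<open>The decrease is available only inside the ball of radius \<open>r\<close>, and the
  ellipsoid need not lie in that ball. The work is thus to keep the iterates in the ball; a
  geometric decay of \<open>V\<close> then gives the rate.\<close>

lemma lyapunov_decrease_imp_exponential:
  fixes \<Gamma> P :: "real^'n^'n" and f :: "real^'n \<Rightarrow> real^'n"
  assumes \<Gamma>: "pos_def \<Gamma>" and inv: "\<And>x. \<Gamma> *v (P *v x) = x"
    and "0 < \<epsilon>" and "0 < r"
    and dec: "\<And>x. \<lbrakk>x \<in> cball 0 r; x \<in> ellipsoid P 1\<rbrakk>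
      \<Longrightarrow> f x \<bullet> (P *v f x) \<le> x \<bullet> (P *v x) - \<epsilon> * (norm (P *v x))\<^sup>2"
  obtains c \<rho> where "0 < c" and "0 < \<rho>" and "\<rho> < 1"
    and "\<And>x k. x \<in> cball 0 (attraction_radius \<Gamma> \<epsilon> r) \<inter> ellipsoid P 1
      \<Longrightarrow> (f ^^ k) x \<in> cball 0 r \<and> norm ((f ^^ k) x) \<le> c * \<rho> ^ k * norm x"
proof -
  define l m d V where "l = lambda_min \<Gamma>" and "m = lambda_max \<Gamma>"
    and "d = m\<^sup>2 - \<epsilon> * l" and "V x = x \<bullet> (P *v x)" for x
  have sym: "transpose \<Gamma> = \<Gamma>"
    using \<Gamma> by (simp add: pos_def_def)
  have lower: "l * (norm \<xi>)\<^sup>2 \<le> \<xi> \<bullet> (\<Gamma> *v \<xi>)" and upper: "\<xi> \<bullet> (\<Gamma> *v \<xi>) \<le> m * (norm \<xi>)\<^sup>2" for \<xi>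
    unfolding l_def m_def using sym by (simp_all add: lambda_min_bound lambda_max_bound)
  \<comment> \<open>The least eigenvalue is attained, so positivity of the form at its eigenvector
    makes \<open>l\<close> positive.\<close>
  obtain v where v: "v \<noteq> 0" "\<Gamma> *v v = l *\<^sub>R v"
    using lambda_min_eigenvalue[OF sym] by (auto simp: l_def eigenvalues_def)
  then have "0 < v \<bullet> (l *\<^sub>R v)"
    using \<Gamma> by (metis pos_def_def)
  then have "0 < l * (norm v)\<^sup>2"
    by (simp add: power2_norm_eq_inner)
  then have "0 < l"
    using zero_less_mult_pos2 v(1) by force
  have "l * (norm v)\<^sup>2 \<le> m * (norm v)\<^sup>2"
    using lower upper order_trans by blast
  then have "l \<le> m"
    using v(1) by simp
  with \<open>0 < l\<close> have "0 < m"
    by simp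
  have V_inv: "V x = (P *v x) \<bullet> (\<Gamma> *v (P *v x))" for x
    by (simp add: V_def inv inner_commute)
  have ellipsoid_iff: "x \<in> ellipsoid P 1 \<longleftrightarrow> V x \<le> 1" for x
    by (simp add: ellipsoid_def V_def)
  have V_nonneg: "0 \<le> V x" for x
    using lower[of "P *v x"] \<open>0 < l\<close> by (simp add: V_inv order_trans[rotated])
  have psd: "pos_semidef \<Gamma>"
    using \<Gamma> by (metis inner_zero_left less_eq_real_def pos_def_def pos_semidef_def)
  \<comment> \<open>Cauchy-Schwarz for \<Gamma> between \<open>x\<close> and \<open>P *v x\<close>,
    whose mixed term is |x|^2; one factor |x|^2 is then cancelled.\<close>
  have norm_le_V: "(norm x)\<^sup>2 \<le> m * V x" for x
  proof (cases "x = 0")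
    case False
    have "((norm x)\<^sup>2)\<^sup>2 \<le> (x \<bullet> (\<Gamma> *v x)) * V x"
      using pos_semidef_cauchy_schwarz[OF psd, of x "P *v x"]
      unfolding inv V_def power2_norm_eq_inner by (simp only: inner_commute[of "P *v x" x])
    also have "\<dots> \<le> (m * (norm x)\<^sup>2) * V x"
      by (intro mult_right_mono upper V_nonneg)
    finally have "(norm x)\<^sup>2 * (norm x)\<^sup>2 \<le> (norm x)\<^sup>2 * (m * V x)"
      by (simp only: power2_eq_square[of "(norm x)\<^sup>2"] mult_ac)
    moreover have "0 < (norm x)\<^sup>2"
      using False by simp
    ultimately show ?thesis
      using mult_le_cancel_left_pos by blast
  qed (simp add: V_def)
  have V_le: "V x \<le> norm (P *v x) * norm x" for x
    unfolding V_def by (metis inner_commute norm_cauchy_schwarz)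
  have norm_le: "norm x \<le> m * norm (P *v x)" for x
  proof (cases "x = 0")
    case False
    have "(norm x)\<^sup>2 \<le> m * V x"
      by (rule norm_le_V)
    also have "\<dots> \<le> m * (norm (P *v x) * norm x)"
      using V_le \<open>0 < m\<close> by simp
    finally have "norm x * norm x \<le> (m * norm (P *v x)) * norm x"
      by (simp add: power2_eq_square)
    then show ?thesis
      using False by simp
  qed (use \<open>0 < m\<close> in simp)
  \<comment> \<open>Square \<open>V_le\<close>, absorb \<open>l * (norm (P *v x))\<^sup>2\<close>
    into \<open>V x\<close>, and cancel one factor \<open>V x\<close>.\<close>
  have V_le_norm: "l * V x \<le> (norm x)\<^sup>2" for x
  proof (cases "V x = 0")
    case False
    have "(V x)\<^sup>2 \<le> (norm (P *v x) * norm x)\<^sup>2"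
      by (intro power_mono V_le V_nonneg)
    then have "l * (V x)\<^sup>2 \<le> (l * (norm (P *v x))\<^sup>2) * (norm x)\<^sup>2"
      using \<open>0 < l\<close> by (simp add: power_mult_distrib)
    also have "\<dots> \<le> V x * (norm x)\<^sup>2"
      using lower[of "P *v x"] by (intro mult_right_mono) (simp_all add: V_inv)
    finally have "V x * (l * V x) \<le> V x * (norm x)\<^sup>2"
      by (simp add: power2_eq_square mult_ac)
    then show ?thesis
      using False V_nonneg[of x] by simp
  qed simp
  have step: "V (f x) \<le> V x - \<epsilon> / m\<^sup>2 * (norm x)\<^sup>2" if "x \<in> cball 0 r" "x \<in> ellipsoid P 1" for x
  proof -
    have "(norm x)\<^sup>2 \<le> m\<^sup>2 * (norm (P *v x))\<^sup>2"
      unfolding power_mult_distrib[symmetric] by (intro power_mono norm_le norm_ge_zero)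
    then have "\<epsilon> / m\<^sup>2 * (norm x)\<^sup>2 \<le> \<epsilon> * (norm (P *v x))\<^sup>2"
      using \<open>0 < m\<close> \<open>0 < \<epsilon>\<close> by (simp add: field_simps)
    then show ?thesis
      using dec[OF that] by (simp add: V_def)
  qed
  \<comment> \<open>Here \<open>d\<close> is the denominator in the radius. The bound is kept free
    of division by \<open>d\<close>, so that it holds whatever the sign of \<open>d\<close>.\<close>
  have first_step: "l * m * (m * V (f x)) \<le> d * (norm x)\<^sup>2"
    if "x \<in> cball 0 r" "x \<in> ellipsoid P 1" for x
  proof -
    have "l * m * (m * V (f x)) \<le> l * m * (m * (V x - \<epsilon> / m\<^sup>2 * (norm x)\<^sup>2))"
      using step[OF that] \<open>0 < l\<close> \<open>0 < m\<close> by simp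
    also have "\<dots> = m\<^sup>2 * (l * V x) - \<epsilon> * l * (norm x)\<^sup>2"
      using \<open>0 < m\<close> by (simp add: field_simps power2_eq_square)
    also have "\<dots> \<le> m\<^sup>2 * (norm x)\<^sup>2 - \<epsilon> * l * (norm x)\<^sup>2"
      using V_le_norm[of x] by (simp add: mult_left_mono)
    finally show ?thesis
      by (simp add: d_def algebra_simps)
  qed
  have radius: "norm x \<le> r" "m * V (f x) \<le> r\<^sup>2"
    if x: "x \<in> cball 0 (attraction_radius \<Gamma> \<epsilon> r)" "x \<in> ellipsoid P 1" for x
  proof -
    have r0: "attraction_radius \<Gamma> \<epsilon> r = (if d = 0 then r else min r (sqrt (m * l / d) * r))"
      by (simp add: attraction_radius_def d_def l_def m_def Let_def)
    then show "norm x \<le> r"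
      using x by (auto split: if_splits)
    then have fs: "l * m * (m * V (f x)) \<le> d * (norm x)\<^sup>2"
      using first_step x by simp
    \<comment> \<open>For \<open>d < 0\<close> the radius is negative, as \<open>sqrt\<close> is odd, and there is no such \<open>x\<close>.\<close>
    have "d * (norm x)\<^sup>2 \<le> l * m * r\<^sup>2"
    proof (cases "d = 0")
      case True
      then show ?thesis
        using \<open>0 < l\<close> \<open>0 < m\<close> by simp
    next
      case False
      then have le: "norm x \<le> sqrt (m * l / d) * r"
        using x r0 by simp
      have "0 \<le> sqrt (m * l / d) * r"
        using le norm_ge_zero order_trans by blast
      then have "0 \<le> m * l / d"
        using \<open>0 < r\<close> by (simp add: zero_le_mult_iff)
      then have "0 < d"
        using False mult_pos_pos[OF \<open>0 < m\<close> \<open>0 < l\<close>] by (metis divide_pos_neg linorder_neqE not_le)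
      have "(norm x)\<^sup>2 \<le> (sqrt (m * l / d) * r)\<^sup>2"
        using le by (intro power_mono) simp_all
      also have "\<dots> = m * l / d * r\<^sup>2"
        using \<open>0 \<le> m * l / d\<close> by (simp add: power_mult_distrib)
      finally show ?thesis
        using \<open>0 < d\<close> by (simp add: field_simps)
    qed
    with fs have "l * m * (m * V (f x)) \<le> l * m * r\<^sup>2"
      by simp
    then show "m * V (f x) \<le> r\<^sup>2"
      using \<open>0 < l\<close> \<open>0 < m\<close> by simp
  qed
  \<comment> \<open>The maximum with \<open>1 / 2\<close> keeps the rate positive.\<close>
  define q where "q = max (1 / 2) (1 - \<epsilon> * l / m\<^sup>2)"
  have q: "0 < q" "q < 1"
    using \<open>0 < \<epsilon>\<close> \<open>0 < l\<close> \<open>0 < m\<close> by (simp_all add: q_def)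
  have contraction: "V (f x) \<le> q * V x" if "x \<in> cball 0 r" "x \<in> ellipsoid P 1" for x
  proof -
    have "\<epsilon> / m\<^sup>2 * (l * V x) \<le> \<epsilon> / m\<^sup>2 * (norm x)\<^sup>2"
      using V_le_norm \<open>0 < \<epsilon>\<close> by (intro mult_left_mono) simp_all
    then have "V (f x) \<le> (1 - \<epsilon> * l / m\<^sup>2) * V x"
      using step[OF that] by (simp add: algebra_simps)
    also have "\<dots> \<le> q * V x"
      by (intro mult_right_mono V_nonneg) (simp add: q_def)
    finally show ?thesis .
  qed
  \<comment> \<open>The last conjunct looks one step ahead: with \<open>norm_le_V\<close> it puts
    the next iterate into the ball. It persists because \<open>V\<close> does not increase.\<close>
  have invariant: "norm ((f ^^ k) x) \<le> r \<and> V ((f ^^ k) x) \<le> 1 \<and> V ((f ^^ k) x) \<le> q ^ k * V x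
      \<and> m * V (f ((f ^^ k) x)) \<le> r\<^sup>2"
    if x: "x \<in> cball 0 (attraction_radius \<Gamma> \<epsilon> r)" "x \<in> ellipsoid P 1" for x k
  proof (induction k)
    case 0
    then show ?case
      using radius[OF x] x(2) by (simp add: ellipsoid_iff)
  next
    case (Suc k)
    let ?y = "(f ^^ k) x" and ?z = "f ((f ^^ k) x)"
    have "(norm ?z)\<^sup>2 \<le> r\<^sup>2"
      using norm_le_V[of ?z] Suc.IH by linarith
    then have z: "norm ?z \<le> r"
      by (rule power2_le_imp_le) (use \<open>0 < r\<close> in simp)
    have Vz: "V ?z \<le> q * V ?y"
      by (rule contraction) (use Suc.IH in \<open>simp_all add: ellipsoid_iff\<close>)
    also have "\<dots> \<le> 1"
      using q Suc.IH V_nonneg[of ?y] by (simp add: mult_le_one)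
    finally have "V ?z \<le> 1" .
    \<comment> \<open>The contraction is applied a second time, now at the new iterate, to renew the
      look-ahead bound.\<close>
    with z have "V (f ?z) \<le> q * V ?z"
      by (intro contraction) (simp_all add: ellipsoid_iff)
    also have "\<dots> \<le> V ?z"
      using q V_nonneg[of ?z] by (simp add: mult_left_le_one_le)
    finally have "m * V (f ?z) \<le> m * V ?z"
      using \<open>0 < m\<close> by simp
    moreover have "q * V ?y \<le> q * (q ^ k * V x)"
      using Suc.IH q by simp
    ultimately show ?case
      using z \<open>V ?z \<le> 1\<close> Vz Suc.IH by (simp add: mult.assoc)
  qed
  \<comment> \<open>\<open>V\<close> is quadratic in the state, hence the rate
    \<open>sqrt q\<close>. The factor \<open>sqrt (m / l)\<close> comes from passing from the norm
    to \<open>V\<close> at time 0 and back at time \<open>k\<close>.\<close>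
  have "norm ((f ^^ k) x) \<le> sqrt (m / l) * sqrt q ^ k * norm x"
    if x: "x \<in> cball 0 (attraction_radius \<Gamma> \<epsilon> r)" "x \<in> ellipsoid P 1" for x k
  proof (rule power2_le_imp_le)
    have "(norm ((f ^^ k) x))\<^sup>2 \<le> m * V ((f ^^ k) x)"
      by (rule norm_le_V)
    also have "\<dots> \<le> m * (q ^ k * V x)"
      using invariant[OF x, of k] \<open>0 < m\<close> by simp
    also have "\<dots> = m / l * q ^ k * (l * V x)"
      using \<open>0 < l\<close> by simp
    also have "\<dots> \<le> m / l * q ^ k * (norm x)\<^sup>2"
      using V_le_norm \<open>0 < l\<close> \<open>0 < m\<close> q by (intro mult_left_mono) simp_all
    also have "\<dots> = (sqrt (m / l) * sqrt q ^ k * norm x)\<^sup>2"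
      using \<open>0 < l\<close> \<open>0 < m\<close> q
      by (simp add: power_mult_distrib real_sqrt_power[symmetric] zero_le_power)
    finally show "(norm ((f ^^ k) x))\<^sup>2 \<le> (sqrt (m / l) * sqrt q ^ k * norm x)\<^sup>2" .
  qed (use \<open>0 < l\<close> \<open>0 < m\<close> q in simp)
  then show thesis
    using \<open>0 < l\<close> \<open>0 < m\<close> q invariant by (intro that[of "sqrt (m / l)" "sqrt q"]) auto
qed

section \<open>The saturated closed loop and its Lyapunov decrease\<close>

theorem theorem3:
  fixes X :: "(real^'n) set"
    and A :: "real^'n \<Rightarrow> real^'n^'n"
    and B :: "real^'n \<Rightarrow> real^'m^'n"
    and ubar :: "real^'m"
    and r \<epsilon> :: real
    and \<Gamma> P :: "real^'n^'n"
    and Y W K :: "real^'n^'m"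
    and S :: "real^'m^'m"
  assumes "0 \<in> X"
    and "\<And>i j. continuous_on X (\<lambda>x. A x $ i $ j)"
    and "\<And>i j. continuous_on X (\<lambda>x. B x $ i $ j)"
    and "\<And>i. 0 < ubar $ i"
    and "0 < r"
    and "cball 0 r \<subseteq> X"
    and "transpose \<Gamma> = \<Gamma>"
    and "loewner_less 0 \<Gamma>"
    and "0 < \<epsilon>"
    and "diagonal_mat S"
    and "loewner_less 0 S"
    and "\<And>i. loewner_le 0
          (vcat (hcat \<Gamma> (transpose (rowvector (W $ i) :: real^'n^1)))
                (hcat (rowvector (W $ i)) (mat ((ubar $ i)\<^sup>2))))"
    and "\<And>G. G \<in> vertex_set A B r \<Longrightarrow> loewner_le
          (vcat (hcat (- \<Gamma> + \<epsilon> *\<^sub>R mat 1)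
                      (hcat (- transpose Y - transpose W)
                            (transpose (vcat \<Gamma> Y) ** transpose G)))
          (vcat (hcat (- Y - W)
                      (hcat (- (2 *\<^sub>R S))
                            (transpose (vcat 0 S) ** transpose G)))
                (hcat (G ** vcat \<Gamma> Y)
                      (hcat (G ** vcat 0 S)
                            (- \<Gamma>)))))
          0"
    and "K = Y ** matrix_inv \<Gamma>"
    and "P = matrix_inv \<Gamma>"
  shows "region_of_attraction X (closed_loop A B ubar K)
           (cball 0 (attraction_radius \<Gamma> \<epsilon> r) \<inter> ellipsoid P 1) \<and>
         exponentially_convergent X (closed_loop A B ubar K)
           (cball 0 (attraction_radius \<Gamma> \<epsilon> r) \<inter> ellipsoid P 1)"
proof -
  note A_cont = assms(2) and B_cont = assms(3) and ubar_pos = assms(4) and ball = assms(6)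
    and diag = assms(10) and row_lmi = assms(12) and vertex_lmi = assms(13)
    and K = assms(14) and P = assms(15)
  define f where "f = closed_loop A B ubar K"
  have \<Gamma>: "pos_def \<Gamma>" and S: "pos_def S"
    using assms(8,11) by (simp_all add: loewner_less_def)
  have inv: "\<Gamma> *v (P *v x) = x" for x
    unfolding P using \<Gamma> by (rule pos_def_matrix_inv)
  have decrease: "f x \<bullet> (P *v f x) \<le> x \<bullet> (P *v x) - \<epsilon> * (norm (P *v x))\<^sup>2"
    if x: "x \<in> cball 0 r" "x \<in> ellipsoid P 1" for x
  proof -
    \<comment> \<open>The choice of \<open>v\<close> makes \<open>Y *v \<xi> + S *v v\<close> equal
      to the saturated input \<open>s\<close>, so the vertex terms of the block form become a vertex
      version of \<open>f x\<close>.\<close>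
    define \<xi> w s v where "\<xi> = P *v x" and "w = P *v f x" and "s = sat ubar (Y *v \<xi>)"
      and "v = (\<chi> i. (s $ i - (Y *v \<xi>) $ i) / S $ i $ i)"
    have x_eq: "\<Gamma> *v \<xi> = x" and f_eq: "\<Gamma> *v w = f x"
      by (simp_all add: \<xi>_def w_def inv)
    have "K *v x = Y *v \<xi>"
      by (simp add: K P \<xi>_def matrix_vector_mul_assoc)
    then have f_split: "f x = A x *v x + B x *v s"
      by (simp add: f_def closed_loop_def s_def)
    have S_pos: "0 < S $ i $ i" for i
      using S by (rule pos_def_diag_entry)
    then have S_nonzero: "S $ i $ i \<noteq> 0" for i
      by (metis less_irrefl)
    have Sv: "Y *v \<xi> + S *v v = s"
      using S_nonzero by (simp add: vec_eq_iff diagonal_mat_mult[OF diag] v_def)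
    \<comment> \<open>Up to the positive factor \<open>1 / S $ i $ i\<close> this is the sector
      condition with \<open>h\<close> the \<open>i\<close>-th component of
      \<open>W *v \<xi>\<close>, which the row inequality bounds since the form of \<Gamma> at \<xi>
      equals \<open>V x\<close>.\<close>
    have "v $ i * (s $ i + (W *v \<xi>) $ i) \<le> 0" for i
    proof -
      have "\<xi> \<bullet> (\<Gamma> *v \<xi>) \<le> 1"
        using x(2) unfolding x_eq by (simp add: ellipsoid_def \<xi>_def inner_commute)
      with row_lmi have "((W *v \<xi>) $ i)\<^sup>2 \<le> (ubar $ i)\<^sup>2"
        unfolding matrix_vector_mul_component by (rule ellipsoid_row_bound)
      then have "(s $ i - (Y *v \<xi>) $ i) * (s $ i + (W *v \<xi>) $ i) \<le> 0"
        unfolding s_def by (intro sat_sector ubar_pos)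
      then show ?thesis
        using S_pos[of i] by (simp add: v_def divide_le_0_iff)
    qed
    then have sector: "v \<bullet> (s + W *v \<xi>) \<le> 0"
      by (simp add: inner_vec_def sum_nonpos)
    \<comment> \<open>The two blocks are maximised independently and still form one vertex. This
      vertex depends on \<open>x\<close>, which is harmless as the inequality holds at all
      vertices.\<close>
    obtain \<alpha> where \<alpha>: "\<And>i j. \<alpha> $ i $ j \<in> {entry_max A r i j, entry_min A r i j}"
        "w \<bullet> (A x *v x) \<le> w \<bullet> (\<alpha> *v x)"
      using bilinear_le_vertex[of "entry_min A r" "A x" "entry_max A r" w x]
        entry_bounds[OF continuous_on_subset[OF A_cont ball] x(1)] by blast
    obtain \<beta> where \<beta>: "\<And>i j. \<beta> $ i $ j \<in> {entry_max B r i j, entry_min B r i j}"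
        "w \<bullet> (B x *v s) \<le> w \<bullet> (\<beta> *v s)"
      using bilinear_le_vertex[of "entry_min B r" "B x" "entry_max B r" w s]
        entry_bounds[OF continuous_on_subset[OF B_cont ball] x(1)] by blast
    have "hcat \<alpha> \<beta> \<in> vertex_set A B r"
      unfolding vertex_set_def using \<alpha>(1) \<beta>(1) by blast
    from lmi_quadratic_form[OF vertex_lmi[OF this], of w \<xi> v]
    have "2 * (w \<bullet> (\<alpha> *v x) + w \<bullet> (\<beta> *v s)) - w \<bullet> f x
        \<le> \<xi> \<bullet> x - \<epsilon> * (norm \<xi>)\<^sup>2 + 2 * (v \<bullet> (s + W *v \<xi>))"
      by (simp add: x_eq f_eq Sv[symmetric] add_ac)
    \<comment> \<open>Here \<open>b\<close> is \<open>w \<bullet> f x\<close>, which is also the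
      form of \<Gamma> at \<open>w\<close>, and \<open>a\<close> is the vertex value dominating it.
      Hence \<open>2 * a - b\<close> is at least \<open>b\<close>, the new value of
      \<open>V\<close>.\<close>
    moreover have "b \<le> R" if "2 * a - b \<le> R + 2 * t" "b \<le> a" "t \<le> 0" for a b R t :: real
      using that by linarith
    moreover have "w \<bullet> f x \<le> w \<bullet> (\<alpha> *v x) + w \<bullet> (\<beta> *v s)"
      using \<alpha>(2) \<beta>(2) by (simp add: f_split inner_add_right)
    ultimately have "w \<bullet> f x \<le> \<xi> \<bullet> x - \<epsilon> * (norm \<xi>)\<^sup>2"
      using sector by blast
    then show ?thesis
      by (simp add: \<xi>_def w_def inner_commute)
  qed
  obtain c \<rho> where c: "0 < c" "0 < \<rho>" "\<rho> < 1"
    and bound: "\<And>x k. x \<in> cball 0 (attraction_radius \<Gamma> \<epsilon> r) \<inter> ellipsoid P 1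
      \<Longrightarrow> (f ^^ k) x \<in> cball 0 r \<and> norm ((f ^^ k) x) \<le> c * \<rho> ^ k * norm x"
    using lyapunov_decrease_imp_exponential[OF \<Gamma> inv \<open>0 < \<epsilon>\<close> \<open>0 < r\<close> decrease] by blast
  have "(\<lambda>k. (f ^^ k) x) \<longlonglongrightarrow> 0"
    if "x \<in> cball 0 (attraction_radius \<Gamma> \<epsilon> r) \<inter> ellipsoid P 1" for x
  proof (rule Lim_null_comparison)
    show "\<forall>\<^sub>F k in sequentially. norm ((f ^^ k) x) \<le> c * \<rho> ^ k * norm x"
      using bound[OF that] by simp
    have "(\<lambda>k. \<rho> ^ k) \<longlonglongrightarrow> 0"
      using c by (intro LIMSEQ_power_zero) simp
    then show "(\<lambda>k. c * \<rho> ^ k * norm x) \<longlonglongrightarrow> 0"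
      by (intro tendsto_mult_left_zero tendsto_mult_right_zero)
  qed
  then show ?thesis
    unfolding region_of_attraction_def exponentially_convergent_def f_def[symmetric]
    using bound ball c by blast
qed

end
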